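(* Let $\Omega_1^h,\Omega_2^h\in\mathcal{A}_{\mathrm{AD}}$ be adapted families of connection $1$-forms. Suppose both are $\frac1h$-linear, i.e. $h\Omega_1^h$ and $h\Omega_2^h$ are independent of $h$, and suppose that they are adapted gauge equivalent, i.e. there is $U\in\mathcal{G}_{\mathrm{AD}}$ with $\Omega_2^h=U^*\Omega_1^h$. Then $\Omega_1^h=\Omega_2^h$.
   Context: Fix integers $N\ge 5$ and $k\ge 1$ with $N>k$. Let $t$ be the coordinate on $\mathbb{C}$, $q=e^t$, $\partial=\partial/\partial t=q\,\partial/\partial q$ (so $dq=q\,dt$), and let $h$ be a parameter (a loop parameter, $h\in S^1\subset\mathbb{C}$). Grade polynomials in $q$ and $h$ (and their products with powers of $h^{-1}$) by $\deg h=2$, $\deg q=2(N-k)$. Matrices are $(N-1)\times(N-1)$ complex matrices, with rows and columns indexed by $0,\dots,N-2$. For an integer $n$, the $n$-diagonal component of a matrix $(a_{i,j})$ is the part consisting of the entries with $j-i=n$. A matrix-valued function $A$ of $q,h$ is homogeneous if for every $n$ each nonzero entry of its $n$-diagonal component is homogeneous of degree $2n$. Let $I_{-1}$ be the matrix whose $(i+1,i)$ entries are $1$ and whose other entries are $0$. The adapted gauge group $\mathcal{G}_{\mathrm{AD}}$ is the group of $U=U(q,h)$ such that: $U$ is a matrix-valued polynomial in $q$ and $h$ with invertible values (for $q=e^t$, $t\in\mathbb{C}$, $h\in S^1$); $U$ is homogeneous; and $U|_{q=0}=I$. An adapted family of connection $1$-forms is $\Omega^h=\frac1h R^h(q)\,dt$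 where $R^h(q)$ is a matrix-valued polynomial in $q$ and $h$ such that: $\frac1h R^h(q)$ is homogeneous; $R^h(0)=I_{-1}$; and the $(-1)$-diagonal component of $R^h(q)$ is $I_{-1}$. The set of these is $\mathcal{A}_{\mathrm{AD}}$. The group $\mathcal{G}_{\mathrm{AD}}$ acts on $\mathcal{A}_{\mathrm{AD}}$ by $U^*\Omega^h=U^{-1}dU+U^{-1}\Omega^hU$, where $d$ is the exterior derivative in $t$ (so $dU=(\partial U)\,dt$). *)

theory Defs
  imports
    "HOL-Analysis.Derivative"
    "HOL-Library.FuncSet"
    "HOL-Computational_Algebra.Polynomial"
    "Jordan_Normal_Form.Gauss_Jordan_Elimination"
begin

(* A polynomial in q and h is an element of complex poly poly with outer variable q and inner
   variable h: coeff (coeff p a) b is the coefficient of q^a h^b. *)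

type_synonym qh_poly = "complex poly poly"

definition eval_qh :: "qh_poly \<Rightarrow> complex \<Rightarrow> complex \<Rightarrow> complex" where
  "eval_qh p q h = poly (poly p [:q:]) h"

definition eval_mat :: "qh_poly mat \<Rightarrow> complex \<Rightarrow> complex \<Rightarrow> complex mat" where
  "eval_mat A q h = map_mat (\<lambda>p. eval_qh p q h) A"

(* Restriction to q = 0; the result is a matrix of polynomials in h. *)
definition at_q_zero :: "qh_poly mat \<Rightarrow> complex poly mat" where
  "at_q_zero A = map_mat (\<lambda>p. poly p 0) A"

(* h^(-s) p is homogeneous of degree d for the grading deg h = 2, deg q = 2 (N - k).
   The zero polynomial is homogeneous of every degree. *)
definition homogeneous_poly :: "nat \<Rightarrow> nat \<Rightarrow> nat \<Rightarrow> int \<Rightarrow> qh_poly \<Rightarrow> bool" where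
  "homogeneous_poly N k s d p \<longleftrightarrow>
     (\<forall>a b. coeff (coeff p a) b \<noteq> 0 \<longrightarrow>
        2 * (int N - int k) * int a + 2 * (int b - int s) = d)"

definition diagonal_component :: "int \<Rightarrow> 'a::zero mat \<Rightarrow> 'a mat" where
  "diagonal_component n A =
     mat (dim_row A) (dim_col A) (\<lambda>(i, j). if int j - int i = n then A $$ (i, j) else 0)"

(* The matrix h^(-s) A is homogeneous. *)
definition homogeneous_mat :: "nat \<Rightarrow> nat \<Rightarrow> nat \<Rightarrow> qh_poly mat \<Rightarrow> bool" where
  "homogeneous_mat N k s A \<longleftrightarrow>
     (\<forall>n. \<forall>i < dim_row A. \<forall>j < dim_col A.
        diagonal_component n A $$ (i, j) \<noteq> 0 \<longrightarrow>
        homogeneous_poly N k s (2 * n) (diagonal_component n A $$ (i, j)))"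

definition I_minus_one :: "nat \<Rightarrow> 'a::{zero, one} mat" where
  "I_minus_one m = mat m m (\<lambda>(i, j). if i = j + 1 then 1 else 0)"

definition adapted_gauge_group :: "nat \<Rightarrow> nat \<Rightarrow> qh_poly mat set" where
  "adapted_gauge_group N k =
     {U \<in> carrier_mat (N - 1) (N - 1).
        (\<forall>t. \<forall>h \<in> sphere 0 1. invertible_mat (eval_mat U (exp t) h)) \<and>
        homogeneous_mat N k 0 U \<and>
        at_q_zero U = 1\<^sub>m (N - 1)}"

(* A family of matrix-valued 1-forms on the t-plane, indexed by h in the unit circle. The form
   Omega^h = A dt is represented by its coefficient A, and the family is undefined for h outside
   the circle, so that equality of families is equality for all h in the circle and all t. *)

type_synonym form_family = "complex \<Rightarrow> complex \<Rightarrow> complex mat"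

definition adapted_forms :: "nat \<Rightarrow> nat \<Rightarrow> form_family set" where
  "adapted_forms N k =
     {(\<lambda>h \<in> sphere 0 1. \<lambda>t. (1 / h) \<cdot>\<^sub>m eval_mat R (exp t) h) | R.
        R \<in> carrier_mat (N - 1) (N - 1) \<and>
        homogeneous_mat N k 1 R \<and>
        at_q_zero R = I_minus_one (N - 1) \<and>
        diagonal_component (-1) R = I_minus_one (N - 1)}"

definition inverse_h_linear :: "form_family \<Rightarrow> bool" where
  "inverse_h_linear \<Omega> \<longleftrightarrow>
     (\<forall>h \<in> sphere 0 1. \<forall>h' \<in> sphere 0 1. \<forall>t. h \<cdot>\<^sub>m \<Omega> h t = h' \<cdot>\<^sub>m \<Omega> h' t)"

(* The entrywise derivative of U with respect to t, where q = exp t. *)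
definition deriv_t :: "qh_poly mat \<Rightarrow> complex \<Rightarrow> complex \<Rightarrow> complex mat" where
  "deriv_t U h t =
     map_mat (\<lambda>p. deriv (\<lambda>s. eval_qh p (exp s) h) t) U"

definition gauge_action :: "qh_poly mat \<Rightarrow> form_family \<Rightarrow> form_family" where
  "gauge_action U \<Omega> =
     (\<lambda>h \<in> sphere 0 1. \<lambda>t.
        let V = eval_mat U (exp t) h; V_inv = the (mat_inverse V)
        in V_inv * deriv_t U h t + V_inv * \<Omega> h t * V)"

definition adapted_gauge_equivalent ::
    "nat \<Rightarrow> nat \<Rightarrow> form_family \<Rightarrow> form_family \<Rightarrow> bool" where
  "adapted_gauge_equivalent N k \<Omega>\<^sub>1 \<Omega>\<^sub>2 \<longleftrightarrow>
     (\<exists>U \<in> adapted_gauge_group N k. \<Omega>\<^sub>2 = gauge_action U \<Omega>\<^sub>1)"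

end

theory Submission
  imports Defs "HOL-Analysis.Complex_Transcendental"
begin

text \<open>
  Write \<open>\<Omega>\<^sub>i\<^sup>h = (1 / h) \<Theta>\<^sub>i dt\<close>, where \<open>\<Theta>\<^sub>i\<close> does not depend on \<open>h\<close>. Multiplying the gauge
  equation by \<open>h U\<close> turns it into \<open>h \<partial>U + \<Theta>\<^sub>1 U = U \<Theta>\<^sub>2\<close>.
  Expand \<open>U\<close> in powers of \<open>h\<close>, as \<open>U = U\<^sub>0 + h U\<^sub>1 + \<dots> + h\<^sup>m U\<^sub>m\<close>. The two terms with \<open>\<Theta>\<^sub>i\<close> do not
  raise the degree in \<open>h\<close>, so comparing coefficients of \<open>h\<^sup>m\<^sup>+\<^sup>1\<close> gives \<open>\<partial>U\<^sub>m = 0\<close>: the top coefficient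
  is constant in \<open>q\<close>. At \<open>q = 0\<close> the matrix \<open>U\<close> is the identity, so this constant is \<open>0\<close> unless
  \<open>m = 0\<close>. Descending in \<open>m\<close>, one reaches \<open>U = U\<^sub>0\<close> with \<open>\<partial>U\<^sub>0 = 0\<close>, hence \<open>U = 1\<close>, and the identity
  acts trivially.

  The expansion in \<open>h\<close> is legitimate because an equation of polynomials in \<open>h\<close> that holds on the
  unit circle is an identity, the circle being infinite; likewise a polynomial in \<open>q\<close> that vanishes at
  all values \<open>q = e\<^sup>t\<close>, that is for all \<open>q \<noteq> 0\<close>, is zero. The descent is
  \<open>gauge_transformation_trivial\<close>; \<open>gauge_action_intertwines\<close> produces
  the polynomial equation from the gauge action.
\<close>

text \<open>
  Elements of \<open>qh_poly\<close> are polynomials in \<open>q\<close> over polynomials in \<open>h\<close>; the proof sorts them by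
  powers of \<open>h\<close> instead, with coefficients in \<open>\<complex>[q]\<close>.
\<close>

definition h_coeff :: "qh_poly \<Rightarrow> nat \<Rightarrow> complex poly" where
  "h_coeff p b = map_poly (\<lambda>c. coeff c b) p"

lemma coeff_h_coeff: "coeff (h_coeff p b) a = coeff (coeff p a) b"
  by (simp add: h_coeff_def coeff_map_poly)

lemma pderiv_h_coeff: "pderiv (h_coeff p b) = h_coeff (pderiv p) b"
  by (rule poly_eqI) (simp add: coeff_h_coeff coeff_pderiv of_nat_poly)

lemma coeff_poly_const_eq_poly_h_coeff: "coeff (poly p [:q:]) b = poly (h_coeff p b) q"
  by (induction p) (simp_all add: h_coeff_def map_poly_pCons)

lemma has_field_derivative_eval_qh:
  "((\<lambda>q. eval_qh p q h) has_field_derivative eval_qh (pderiv p) q h) (at q)"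
proof (induction p)
  case 0
  show ?case by (simp add: eval_qh_def)
next
  case (pCons a p)
  have "((\<lambda>q. poly a h + q * eval_qh p q h) has_field_derivative
      eval_qh p q h + q * eval_qh (pderiv p) q h) (at q)"
    using pCons.IH by (auto intro!: derivative_eq_intros)
  then show ?case
    by (simp add: eval_qh_def pderiv_pCons)
qed

lemma deriv_eval_qh_exp:
  "deriv (\<lambda>s. eval_qh p (exp s) h) t = exp t * eval_qh (pderiv p) (exp t) h"
proof (rule DERIV_imp_deriv)
  show "((\<lambda>s. eval_qh p (exp s) h) has_field_derivative exp t * eval_qh (pderiv p) (exp t) h) (at t)"
    using DERIV_chain2[OF has_field_derivative_eval_qh DERIV_exp] by (simp add: mult.commute)
qed

text \<open>A finite circle of cardinality \<open>c\<close> could not contain the \<open>c + 1\<close> roots of unity of order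
  \<open>c + 1\<close>.\<close>

lemma infinite_unit_circle: "infinite (sphere (0::complex) 1)"
proof
  assume fin: "finite (sphere (0::complex) 1)"
  define m where "m = Suc (card (sphere (0::complex) 1))"
  have "{z::complex. z ^ m = 1} \<subseteq> sphere 0 1"
  proof
    fix z :: complex assume "z \<in> {z. z ^ m = 1}"
    then have "norm z ^ m = 1" by (simp flip: norm_power)
    then show "z \<in> sphere 0 1"
      by (metis m_def mem_sphere_0 power_eq_1_iff Zero_not_Suc abs_norm_cancel real_norm_def)
  qed
  then have "m \<le> card (sphere (0::complex) 1)"
    using card_mono[OF fin, of "{z. z ^ m = 1}"] card_roots_unity_eq[of m]
    by (metis m_def zero_less_Suc)
  then show False by (simp add: m_def)
qed

lemma poly_eq_if_eq_on_infinite: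
  fixes p r :: "'a::idom poly"
  assumes "infinite S" and "\<And>x. x \<in> S \<Longrightarrow> poly p x = poly r x"
  shows "p = r"
proof (rule ccontr)
  assume "p \<noteq> r"
  then have "finite {x. poly (p - r) x = 0}" by (intro poly_roots_finite) simp
  moreover have "S \<subseteq> {x. poly (p - r) x = 0}" using assms(2) by auto
  ultimately show False using assms(1) finite_subset by blast
qed

lemma eventually_h_coeff_eq_0: "eventually (\<lambda>b. h_coeff p b = 0) sequentially"
proof (induction p)
  case 0
  show ?case by (simp add: h_coeff_def)
next
  case (pCons c p)
  show ?case
    using pCons.IH eventually_gt_at_top[of "degree c"]
    by eventually_elim (simp add: h_coeff_def map_poly_pCons coeff_eq_0)
qed

text \<open>
  The rigidity behind the theorem: the factor \<open>h\<close> in front of the derivative couples the derivative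
  of each coefficient \<open>U\<^sub>b\<close> to \<open>U\<^sub>b\<^sub>+\<^sub>1\<close> alone, so vanishing propagates from high powers of \<open>h\<close> down to
  \<open>U\<^sub>1\<close>, and one last step makes \<open>U\<^sub>0\<close> constant.
\<close>

lemma gauge_transformation_trivial:
  assumes U: "U \<in> carrier_mat n n"
    and \<Theta>\<^sub>1: "\<And>t. \<Theta>\<^sub>1 t \<in> carrier_mat n n" and \<Theta>\<^sub>2: "\<And>t. \<Theta>\<^sub>2 t \<in> carrier_mat n n"
    and U0: "at_q_zero U = 1\<^sub>m n"
    and eq: "\<And>t h. h \<in> sphere 0 1 \<Longrightarrow>
      h \<cdot>\<^sub>m deriv_t U h t + \<Theta>\<^sub>1 t * eval_mat U (exp t) h = eval_mat U (exp t) h * \<Theta>\<^sub>2 t"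
  shows "U = 1\<^sub>m n"
proof -
  \<comment> \<open>For fixed \<open>t\<close>, the entries of \<open>U\<close> and of \<open>\<partial>U\<close> as polynomials in \<open>h\<close>.\<close>
  define u where "u i j t = poly (U $$ (i, j)) [:exp t:]" for i j and t :: complex
  define v where "v i j t = Polynomial.smult (exp t) (poly (pderiv (U $$ (i, j))) [:exp t:])" for i j t
  have h_poly: "pCons 0 (v i j t) + (\<Sum>l<n. Polynomial.smult (\<Theta>\<^sub>1 t $$ (i, l)) (u l j t))
      = (\<Sum>l<n. Polynomial.smult (\<Theta>\<^sub>2 t $$ (l, j)) (u i l t))" if ij: "i < n" "j < n" for i j t
  proof (rule poly_eq_if_eq_on_infinite[OF infinite_unit_circle])
    fix h :: complex assume h: "h \<in> sphere 0 1"
    have "(h \<cdot>\<^sub>m deriv_t U h t + \<Theta>\<^sub>1 t * eval_mat U (exp t) h) $$ (i, j)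
        = (eval_mat U (exp t) h * \<Theta>\<^sub>2 t) $$ (i, j)"
      using eq[OF h] by simp
    then show "poly (pCons 0 (v i j t) + (\<Sum>l<n. Polynomial.smult (\<Theta>\<^sub>1 t $$ (i, l)) (u l j t))) h
        = poly (\<Sum>l<n. Polynomial.smult (\<Theta>\<^sub>2 t $$ (l, j)) (u i l t)) h"
      using ij U \<Theta>\<^sub>1[of t] \<Theta>\<^sub>2[of t]
      by (simp add: deriv_t_def eval_mat_def deriv_eval_qh_exp[unfolded eval_qh_def]
          u_def v_def eval_qh_def
          scalar_prod_def poly_sum lessThan_atLeast0 mult.commute mult.left_commute)
  qed
  \<comment> \<open>The coefficient of \<open>h\<^sup>b\<^sup>+\<^sup>1\<close> of the polynomial identity is
    \<open>\<partial>U\<^sub>b + \<Theta>\<^sub>1 U\<^sub>b\<^sub>+\<^sub>1 = U\<^sub>b\<^sub>+\<^sub>1 \<Theta>\<^sub>2\<close>.\<close>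
  have descent: "pderiv (h_coeff (U $$ (i, j)) b) = 0"
    if top: "\<And>i j. i < n \<Longrightarrow> j < n \<Longrightarrow> h_coeff (U $$ (i, j)) (Suc b) = 0"
      and ij: "i < n" "j < n" for b i j
  proof (rule poly_eq_if_eq_on_infinite)
    show "infinite (UNIV - {0::complex})" by (simp add: infinite_UNIV_char_0)
  next
    fix q :: complex assume "q \<in> UNIV - {0}"
    then have "q \<noteq> 0" by simp
    then obtain t where t: "exp t = q" by (metis exp_Ln)
    have u0: "coeff (u i' j' t) (Suc b) = 0" if "i' < n" "j' < n" for i' j'
      using top[OF that] by (simp add: u_def coeff_poly_const_eq_poly_h_coeff)
    have "coeff (v i j t) b = 0"
      using arg_cong[OF h_poly[OF ij, of t], of "\<lambda>p. coeff p (Suc b)"] ij u0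
      by (simp add: coeff_sum)
    then show "poly (pderiv (h_coeff (U $$ (i, j)) b)) q = poly 0 q"
      using \<open>q \<noteq> 0\<close> by (simp add: v_def t coeff_poly_const_eq_poly_h_coeff pderiv_h_coeff)
  qed
  have at0: "coeff (U $$ (i, j)) 0 = (if i = j then 1 else 0)" if ij: "i < n" "j < n" for i j
  proof -
    have "at_q_zero U $$ (i, j) = 1\<^sub>m n $$ (i, j)" using U0 by simp
    then show ?thesis using ij U by (simp add: at_q_zero_def poly_0_coeff_0)
  qed
  have const: "h_coeff (U $$ (i, j)) b = [:coeff (coeff (U $$ (i, j)) 0) b:]"
    if "pderiv (h_coeff (U $$ (i, j)) b) = 0" for i j b
    by (metis that pderiv_eq_0_iff degree_eq_zeroE coeff_h_coeff coeff_pCons_0)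
  have "eventually (\<lambda>b. \<forall>(i, j)\<in>{..<n} \<times> {..<n}. h_coeff (U $$ (i, j)) b = 0) sequentially"
    by (intro eventually_ball_finite) (auto simp: eventually_h_coeff_eq_0)
  then obtain B where large: "h_coeff (U $$ (i, j)) b = 0"
    if "i < n" "j < n" and "b \<ge> B" for i j b
    by (fastforce simp: eventually_sequentially)
  \<comment> \<open>Only \<open>U\<^sub>b\<close> with \<open>b \<ge> 1\<close> vanish: their value at \<open>q = 0\<close> is \<open>0\<close>, but that of \<open>U\<^sub>0\<close> is the identity.\<close>
  have vanish: "h_coeff (U $$ (i, j)) (Suc b) = 0" if "i < n" "j < n" for i j b
  proof (cases "b \<le> B")
    case True
    then show ?thesis using that
    proof (induction b arbitrary: i j rule: inc_induct)
      case base
      then show ?case using large by simp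
    next
      case (step b)
      then have "h_coeff (U $$ (i, j)) (Suc b) = [:coeff (coeff (U $$ (i, j)) 0) (Suc b):]"
        by (intro const descent) auto
      then show ?case using at0[of i j] step.prems by simp
    qed
  next
    case False
    then show ?thesis using large that by simp
  qed
  have "U $$ (i, j) = 1\<^sub>m n $$ (i, j)" if ij: "i < n" "j < n" for i j
  proof -
    have "coeff (coeff (U $$ (i, j)) a) b = 0" if "a > 0" for a b
      by (metis const[OF descent[OF vanish ij], of b] coeff_h_coeff that coeff_pCons_Suc coeff_0 Suc_pred)
    then have "U $$ (i, j) = [:coeff (U $$ (i, j)) 0:]"
      by (intro poly_eqI) (simp add: coeff_pCons poly_eq_iff split: nat.split)
    then show ?thesis using at0[OF ij] ij by (simp add: one_pCons)
  qed
  then show ?thesis using U by (intro eq_matI) auto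
qed

lemma mat_inverse_invertible:
  fixes V :: "'a::field mat"
  assumes V: "V \<in> carrier_mat n n" and inv: "invertible_mat V"
  shows "the (mat_inverse V) \<in> carrier_mat n n" "V * the (mat_inverse V) = 1\<^sub>m n"
proof -
  obtain W where "V * W = 1\<^sub>m n" "W * V = 1\<^sub>m (dim_row W)"
    using inv V by (auto simp: invertible_mat_def inverts_mat_def)
  then have W: "V * W = 1\<^sub>m n" "W * V = 1\<^sub>m n" "W \<in> carrier_mat n n"
    using V by (metis index_mult_mat(3) index_one_mat(3) carrier_matD carrier_matI)+
  have "mat_inverse V \<noteq> None"
    using mat_inverse(1)[OF V, of undefined] W V
    by (auto simp: Units_def ring_mat_simps)
  then obtain X where X: "mat_inverse V = Some X" by auto
  show "the (mat_inverse V) \<in> carrier_mat n n" "V * the (mat_inverse V) = 1\<^sub>m n"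
    using mat_inverse(2)[OF V X] X by auto
qed

lemma adapted_forms_carrier:
  assumes "\<Omega> \<in> adapted_forms N k" and "h \<in> sphere 0 1"
  shows "\<Omega> h t \<in> carrier_mat (N - 1) (N - 1)"
  using assms by (auto simp: adapted_forms_def eval_mat_def)

lemma adapted_forms_extensional: "\<Omega> \<in> adapted_forms N k \<Longrightarrow> \<Omega> \<in> extensional (sphere 0 1)"
  by (auto simp: adapted_forms_def)

lemma gauge_action_one:
  assumes ext: "\<Omega> \<in> extensional (sphere 0 1)"
    and carrier: "\<And>h t. h \<in> sphere 0 1 \<Longrightarrow> \<Omega> h t \<in> carrier_mat n n"
  shows "gauge_action (1\<^sub>m n) \<Omega> = \<Omega>"
proof (rule extensionalityI[OF _ ext])
  show "gauge_action (1\<^sub>m n) \<Omega> \<in> extensional (sphere 0 1)"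
    by (simp add: gauge_action_def)
next
  fix h :: complex assume h: "h \<in> sphere 0 1"
  have eval: "eval_mat (1\<^sub>m n) q h = 1\<^sub>m n" for q
    by (rule eq_matI) (auto simp: eval_mat_def eval_qh_def)
  have "the (mat_inverse (1\<^sub>m n :: complex mat)) = 1\<^sub>m n"
  proof -
    have "invertible_mat (1\<^sub>m n :: complex mat)"
      by (auto simp: invertible_mat_def inverts_mat_def intro: exI[of _ "1\<^sub>m n"])
    then show ?thesis
      using mat_inverse_invertible[of "1\<^sub>m n :: complex mat" n] by simp
  qed
  moreover have "deriv_t (1\<^sub>m n) h t = 0\<^sub>m n n" for t
    by (rule eq_matI) (auto simp: deriv_t_def deriv_eval_qh_exp eval_qh_def)
  ultimately show "gauge_action (1\<^sub>m n) \<Omega> h = \<Omega> h"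
    using h carrier[OF h]
    by (simp add: gauge_action_def Let_def eval fun_eq_iff left_mult_one_mat[OF carrier[OF h]]
        right_mult_one_mat[OF carrier[OF h]] left_add_zero_mat[OF carrier[OF h]])
qed

text \<open>Multiplying the gauge action by \<open>U\<close> on the left removes the inverse and leaves an equation that
  is polynomial in \<open>U\<close>.\<close>

lemma gauge_action_intertwines:
  assumes U: "U \<in> carrier_mat n n" and inv: "invertible_mat (eval_mat U (exp t) h)"
    and \<Omega>: "\<Omega> h t \<in> carrier_mat n n" and h: "h \<in> sphere 0 1"
  shows "deriv_t U h t + \<Omega> h t * eval_mat U (exp t) h
      = eval_mat U (exp t) h * gauge_action U \<Omega> h t"
proof -
  define V where "V = eval_mat U (exp t) h"
  define W where "W = the (mat_inverse V)"
  have V: "V \<in> carrier_mat n n" using U by (simp add: V_def eval_mat_def)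
  have D: "deriv_t U h t \<in> carrier_mat n n" using U by (simp add: deriv_t_def)
  have W: "W \<in> carrier_mat n n" "V * W = 1\<^sub>m n"
    using mat_inverse_invertible[OF V] inv by (simp_all add: V_def W_def)
  have "V * gauge_action U \<Omega> h t = V * (W * deriv_t U h t + W * \<Omega> h t * V)"
    using h by (simp add: gauge_action_def Let_def V_def W_def)
  also have "\<dots> = V * (W * deriv_t U h t) + V * (W * \<Omega> h t * V)"
    using V W D \<Omega> by (intro mult_add_distrib_mat) auto
  also have "V * (W * deriv_t U h t) = deriv_t U h t"
    using V W D by (simp flip: assoc_mult_mat[of V n n W n _ n])
  also have "W * \<Omega> h t * V = W * (\<Omega> h t * V)"
    using V W \<Omega> by (intro assoc_mult_mat) auto
  also have "V * (W * (\<Omega> h t * V)) = V * W * (\<Omega> h t * V)"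
    using V W \<Omega> by (intro assoc_mult_mat[symmetric]) auto
  also have "\<dots> = \<Omega> h t * V"
    using V W \<Omega> by simp
  finally show ?thesis by (simp add: V_def)
qed

theorem theorem6p1:
  fixes N k :: nat and \<Omega>\<^sub>1 \<Omega>\<^sub>2 :: form_family
  assumes "N \<ge> 5" and "k \<ge> 1" and "N > k"
    and "\<Omega>\<^sub>1 \<in> adapted_forms N k" and "\<Omega>\<^sub>2 \<in> adapted_forms N k"
    and "inverse_h_linear \<Omega>\<^sub>1" and "inverse_h_linear \<Omega>\<^sub>2"
    and "adapted_gauge_equivalent N k \<Omega>\<^sub>1 \<Omega>\<^sub>2"
  shows "\<Omega>\<^sub>1 = \<Omega>\<^sub>2"
proof -
  obtain U where U: "U \<in> adapted_gauge_group N k" and \<Omega>\<^sub>2: "\<Omega>\<^sub>2 = gauge_action U \<Omega>\<^sub>1"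
    using assms(8) by (auto simp: adapted_gauge_equivalent_def)
  have U_carrier: "U \<in> carrier_mat (N - 1) (N - 1)" and U0: "at_q_zero U = 1\<^sub>m (N - 1)"
    and inv: "\<And>t h. h \<in> sphere 0 1 \<Longrightarrow> invertible_mat (eval_mat U (exp t) h)"
    using U by (auto simp: adapted_gauge_group_def)
  note carrier = adapted_forms_carrier[OF assms(4)] adapted_forms_carrier[OF assms(5)]
  \<comment> \<open>The matrix \<open>h \<Omega>\<^sup>h\<close> is the same for all \<open>h\<close> on the circle, so its value at \<open>h = 1\<close> can serve as \<open>\<Theta>\<close>.\<close>
  have linear: "h \<cdot>\<^sub>m \<Omega> h t = \<Omega> 1 t"
    if "inverse_h_linear \<Omega>" "h \<in> sphere 0 1" for \<Omega> h t
  proof -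
    have "h \<cdot>\<^sub>m \<Omega> h t = 1 \<cdot>\<^sub>m \<Omega> 1 t"
      using that unfolding inverse_h_linear_def by (metis mem_sphere_0 norm_one)
    then show ?thesis
      by (metis (mono_tags, lifting) eq_matI index_smult_mat mult_1)
  qed
  have "U = 1\<^sub>m (N - 1)"
  proof (rule gauge_transformation_trivial[where \<Theta>\<^sub>1 = "\<Omega>\<^sub>1 1" and \<Theta>\<^sub>2 = "\<Omega>\<^sub>2 1"])
    fix t h :: complex assume h: "h \<in> sphere 0 1"
    let ?V = "eval_mat U (exp t) h"
    have V: "?V \<in> carrier_mat (N - 1) (N - 1)" using U_carrier by (simp add: eval_mat_def)
    have D: "deriv_t U h t \<in> carrier_mat (N - 1) (N - 1)" using U_carrier by (simp add: deriv_t_def)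
    have "h \<cdot>\<^sub>m (deriv_t U h t + \<Omega>\<^sub>1 h t * ?V) = h \<cdot>\<^sub>m (?V * \<Omega>\<^sub>2 h t)"
      using gauge_action_intertwines[of U "N - 1" t h \<Omega>\<^sub>1] U_carrier inv h carrier \<Omega>\<^sub>2 by simp
    also have "h \<cdot>\<^sub>m (deriv_t U h t + \<Omega>\<^sub>1 h t * ?V)
        = h \<cdot>\<^sub>m deriv_t U h t + h \<cdot>\<^sub>m (\<Omega>\<^sub>1 h t * ?V)"
      using D V carrier(1)[OF h, of t] by (intro add_smult_distrib_left_mat) auto
    also have "h \<cdot>\<^sub>m (\<Omega>\<^sub>1 h t * ?V) = \<Omega>\<^sub>1 1 t * ?V"
      using V carrier(1)[OF h, of t] linear[OF assms(6) h, of t]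
      by (metis mult_smult_assoc_mat)
    also have "h \<cdot>\<^sub>m (?V * \<Omega>\<^sub>2 h t) = ?V * \<Omega>\<^sub>2 1 t"
      using V carrier(2)[OF h, of t] linear[OF assms(7) h, of t]
      by (metis mult_smult_distrib)
    finally show "h \<cdot>\<^sub>m deriv_t U h t + \<Omega>\<^sub>1 1 t * ?V = ?V * \<Omega>\<^sub>2 1 t" .
  qed (use U_carrier U0 carrier in auto)
  then show ?thesis
    using \<Omega>\<^sub>2 gauge_action_one[OF adapted_forms_extensional[OF assms(4)] carrier(1)] by simp
qed

end
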